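(* Let $R$ be a Noetherian domain, $\sigma$ an automorphism of $R$, and $\delta$ a $\sigma$-derivation of $R$. Let $S = R[t;\sigma,\delta]$, let $Q$ be the classical quotient ring of $R$, and extend $(\sigma,\delta)$ to $Q$, so that $S \subseteq Q[t;\sigma,\delta]$. Let $v \in R$ and set $F = t^2 - v$. 1. If $F$ is reducible in $Q[t;\sigma,\delta]$, then $F = (t - \sigma(w))(t + w)$ for some $w \in Q$. In this case $v = \sigma(w)w - \delta(w)$. 2. If $F$ is normal in $S$, then $F$ is prime in $S$ if and only if $F$ is irreducible in $Q[t;\sigma,\delta]$.
   Context: Rings have a multiplicative identity and need not be commutative; Noetherian means left and right Noetherian. A $\sigma$-derivation of $R$ is an additive map $\delta: R \to R$ with $\delta(rs) = \delta(r)s + \sigma(r)\delta(s)$ for all $r,s\in R$. The Ore extension $R[t;\sigma,\delta]$ is the ring of left polynomials $\sum_i r_i t^i$ ($r_i \in R$), free as a left $R$-module on the powers of $t$, with multiplication determined by $tr = \sigma(r)t + \delta(r)$ for $r \in R$. Since $R$ is a Noetherian domain, its classical quotient ring $Q$ is a division ring; $\sigma$ extends uniquely to an automorphism of $Q$ and $\delta$ extends uniquely to a $\sigma$-derivation of $Q$ (again denoted $\sigma,\delta$). A nonzero element $a$ of a ring $A$ is normal if $aA = Aa$. In a domain $A$: an element $a$ is irreducible if it is not a unit and whenever $a = bc$ with $b,c \in A$, either $b$ or $c$ is a unit; a nonzero nonunit that is not irreducible is called reducible. We say $a$ divides $c$, written $a \mid c$, if there exists $b \in A$ with $c = ab$ or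 $c = ba$. An element $a$ is prime if $a \mid bc$ implies $a \mid b$ or $a \mid c$ for all $b,c \in A$. *)

theory Defs
  imports "HOL-Computational_Algebra.Polynomial" "HOL-Algebra.Ring"
begin

section \<open>Coefficient rings\<close>

definition left_ideal :: "'a::ring_1 set \<Rightarrow> bool" where
  "left_ideal I \<longleftrightarrow> 0 \<in> I \<and> (\<forall>x\<in>I. \<forall>y\<in>I. x + y \<in> I) \<and> (\<forall>r. \<forall>x\<in>I. r * x \<in> I)"

definition right_ideal :: "'a::ring_1 set \<Rightarrow> bool" where
  "right_ideal I \<longleftrightarrow> 0 \<in> I \<and> (\<forall>x\<in>I. \<forall>y\<in>I. x + y \<in> I) \<and> (\<forall>r. \<forall>x\<in>I. x * r \<in> I)"

definition left_noetherian :: "'a::ring_1 itself \<Rightarrow> bool" where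
  "left_noetherian _ \<longleftrightarrow>
     (\<forall>I :: nat \<Rightarrow> 'a set. (\<forall>n. left_ideal (I n)) \<and> (\<forall>n. I n \<subseteq> I (Suc n))
        \<longrightarrow> (\<exists>N. \<forall>n\<ge>N. I n = I N))"

definition right_noetherian :: "'a::ring_1 itself \<Rightarrow> bool" where
  "right_noetherian _ \<longleftrightarrow>
     (\<forall>I :: nat \<Rightarrow> 'a set. (\<forall>n. right_ideal (I n)) \<and> (\<forall>n. I n \<subseteq> I (Suc n))
        \<longrightarrow> (\<exists>N. \<forall>n\<ge>N. I n = I N))"

definition noetherian :: "'a::ring_1 itself \<Rightarrow> bool" where
  "noetherian T \<longleftrightarrow> left_noetherian T \<and> right_noetherian T"

definition unital_hom :: "('a::ring_1 \<Rightarrow> 'b::ring_1) \<Rightarrow> bool" where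
  "unital_hom f \<longleftrightarrow>
     (\<forall>x y. f (x + y) = f x + f y) \<and> (\<forall>x y. f (x * y) = f x * f y) \<and> f 1 = 1"

definition automorphism :: "('a::ring_1 \<Rightarrow> 'a) \<Rightarrow> bool" where
  "automorphism \<sigma> \<longleftrightarrow> unital_hom \<sigma> \<and> bij \<sigma>"

definition skew_derivation :: "('a::ring_1 \<Rightarrow> 'a) \<Rightarrow> ('a \<Rightarrow> 'a) \<Rightarrow> bool" where
  "skew_derivation \<sigma> \<delta> \<longleftrightarrow>
     (\<forall>r s. \<delta> (r + s) = \<delta> r + \<delta> s) \<and> (\<forall>r s. \<delta> (r * s) = \<delta> r * s + \<sigma> r * \<delta> s)"

text \<open>
  The division ring on type \<open>'q\<close>, with the embedding \<open>\<iota>\<close> of the domain \<open>'r\<close>, is a two-sided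
  classical quotient ring. In a domain the regular elements are the nonzero ones, and their images
  are invertible because \<open>\<iota>\<close> is injective and \<open>'q\<close> is a division ring; so only the two fraction
  conditions remain.
\<close>

definition classical_quotient_ring ::
    "('r::ring_1_no_zero_divisors \<Rightarrow> 'q::division_ring) \<Rightarrow> bool" where
  "classical_quotient_ring \<iota> \<longleftrightarrow>
     unital_hom \<iota> \<and> inj \<iota> \<and>
     (\<forall>q. \<exists>a s. s \<noteq> 0 \<and> q = \<iota> a * inverse (\<iota> s)) \<and>
     (\<forall>q. \<exists>a s. s \<noteq> 0 \<and> q = inverse (\<iota> s) * \<iota> a)"


section \<open>Ore extensions\<close>

text \<open>
  An element of the Ore extension is a left polynomial: \<open>p :: 'a poly\<close> stands for the sum of
  \<open>coeff p i * t^i\<close>, with coefficients on the left. The commutative multiplication of the type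
  \<open>'a poly\<close> is not used (and is not available for noncommutative \<open>'a\<close>); only its additive
  structure is. Left multiplication by \<open>t\<close> is forced by \<open>t r = \<sigma>(r) t + \<delta>(r)\<close>, and the product of
  \<open>p\<close> and \<open>q\<close> is the sum of \<open>coeff p i * (t^i q)\<close>.
\<close>

definition ore_shift :: "('a::ring_1 \<Rightarrow> 'a) \<Rightarrow> ('a \<Rightarrow> 'a) \<Rightarrow> 'a poly \<Rightarrow> 'a poly" where
  "ore_shift \<sigma> \<delta> q = pCons 0 (map_poly \<sigma> q) + map_poly \<delta> q"

definition ore_mult :: "('a::ring_1 \<Rightarrow> 'a) \<Rightarrow> ('a \<Rightarrow> 'a) \<Rightarrow> 'a poly \<Rightarrow> 'a poly \<Rightarrow> 'a poly" where
  "ore_mult \<sigma> \<delta> p q =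
     (\<Sum>i\<le>degree p. map_poly (\<lambda>x. coeff p i * x) ((ore_shift \<sigma> \<delta> ^^ i) q))"

definition ore_ext :: "('a::ring_1 \<Rightarrow> 'a) \<Rightarrow> ('a \<Rightarrow> 'a) \<Rightarrow> 'a poly ring" where
  "ore_ext \<sigma> \<delta> =
     \<lparr>carrier = UNIV, monoid.mult = ore_mult \<sigma> \<delta>, one = [:1:], zero = 0, add = (+)\<rparr>"


section \<open>Divisibility in a noncommutative ring\<close>

definition normal_elem :: "('a, 'm) ring_scheme \<Rightarrow> 'a \<Rightarrow> bool" where
  "normal_elem A a \<longleftrightarrow> a \<in> carrier A \<and> a \<noteq> \<zero>\<^bsub>A\<^esub> \<and>
     {a \<otimes>\<^bsub>A\<^esub> x | x. x \<in> carrier A} = {x \<otimes>\<^bsub>A\<^esub> a | x. x \<in> carrier A}"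

definition irreducible_elem :: "('a, 'm) ring_scheme \<Rightarrow> 'a \<Rightarrow> bool" where
  "irreducible_elem A a \<longleftrightarrow> a \<in> carrier A \<and> a \<notin> Units A \<and>
     (\<forall>b\<in>carrier A. \<forall>c\<in>carrier A. a = b \<otimes>\<^bsub>A\<^esub> c \<longrightarrow> b \<in> Units A \<or> c \<in> Units A)"

definition reducible_elem :: "('a, 'm) ring_scheme \<Rightarrow> 'a \<Rightarrow> bool" where
  "reducible_elem A a \<longleftrightarrow>
     a \<in> carrier A \<and> a \<noteq> \<zero>\<^bsub>A\<^esub> \<and> a \<notin> Units A \<and> \<not> irreducible_elem A a"

definition divides_elem :: "('a, 'm) ring_scheme \<Rightarrow> 'a \<Rightarrow> 'a \<Rightarrow> bool" where
  "divides_elem A a c \<longleftrightarrow> (\<exists>b\<in>carrier A. c = a \<otimes>\<^bsub>A\<^esub> b \<or> c = b \<otimes>\<^bsub>A\<^esub> a)"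

text \<open>Zero and units are not excluded here.\<close>

definition prime_elem_nc :: "('a, 'm) ring_scheme \<Rightarrow> 'a \<Rightarrow> bool" where
  "prime_elem_nc A a \<longleftrightarrow> a \<in> carrier A \<and>
     (\<forall>b\<in>carrier A. \<forall>c\<in>carrier A.
        divides_elem A a (b \<otimes>\<^bsub>A\<^esub> c) \<longrightarrow> divides_elem A a b \<or> divides_elem A a c)"


section \<open>The Ore extension is a ring with the expected presentation\<close>

lemma automorphism_0:
  assumes "automorphism \<sigma>"
  shows "\<sigma> 0 = 0"
  using assms unfolding automorphism_def unital_hom_def by (metis add_cancel_right_left)

lemma skew_derivation_0:
  assumes "skew_derivation \<sigma> \<delta>"
  shows "\<delta> 0 = 0"
  using assms unfolding skew_derivation_def by (metis add_cancel_right_left)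

lemma coeff_ore_shift:
  assumes "automorphism \<sigma>" "skew_derivation \<sigma> \<delta>"
  shows "coeff (ore_shift \<sigma> \<delta> q) n =
           (case n of 0 \<Rightarrow> 0 | Suc m \<Rightarrow> \<sigma> (coeff q m)) + \<delta> (coeff q n)"
  by (simp add: ore_shift_def coeff_map_poly coeff_pCons automorphism_0[OF assms(1)]
        skew_derivation_0[OF assms(2)] split: nat.split)

lemma ore_shift_add:
  assumes "automorphism \<sigma>" "skew_derivation \<sigma> \<delta>"
  shows "ore_shift \<sigma> \<delta> (p + q) = ore_shift \<sigma> \<delta> p + ore_shift \<sigma> \<delta> q"
  using assms
  by (intro poly_eqI)
     (simp add: coeff_ore_shift automorphism_def unital_hom_def skew_derivation_def
        algebra_simps split: nat.split)

lemma ore_shift_0: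
  assumes "automorphism \<sigma>" "skew_derivation \<sigma> \<delta>"
  shows "ore_shift \<sigma> \<delta> 0 = 0"
  using ore_shift_add[OF assms, of 0 0] by simp

lemma ore_shift_scale:
  assumes "automorphism \<sigma>" "skew_derivation \<sigma> \<delta>"
  shows "ore_shift \<sigma> \<delta> (map_poly (\<lambda>x. a * x) q) =
           map_poly (\<lambda>x. \<sigma> a * x) (ore_shift \<sigma> \<delta> q) + map_poly (\<lambda>x. \<delta> a * x) q"
  using assms
  by (intro poly_eqI)
     (simp add: coeff_ore_shift coeff_map_poly automorphism_def unital_hom_def skew_derivation_def
        algebra_simps split: nat.split)

lemma ore_shift_funpow_add:
  assumes "automorphism \<sigma>" "skew_derivation \<sigma> \<delta>"
  shows "(ore_shift \<sigma> \<delta> ^^ i) (p + q) = (ore_shift \<sigma> \<delta> ^^ i) p + (ore_shift \<sigma> \<delta> ^^ i) q"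
  by (induction i) (simp_all add: ore_shift_add[OF assms])

lemma ore_shift_funpow_0:
  assumes "automorphism \<sigma>" "skew_derivation \<sigma> \<delta>"
  shows "(ore_shift \<sigma> \<delta> ^^ i) 0 = 0"
  by (induction i) (simp_all add: ore_shift_0[OF assms])

lemma ore_shift_sum:
  assumes "automorphism \<sigma>" "skew_derivation \<sigma> \<delta>"
  shows "ore_shift \<sigma> \<delta> (\<Sum>i\<in>A. f i) = (\<Sum>i\<in>A. ore_shift \<sigma> \<delta> (f i))"
  by (induction A rule: infinite_finite_induct)
     (simp_all add: ore_shift_add[OF assms] ore_shift_0[OF assms])

lemma map_poly_scale_add:
  fixes p q :: "'a::ring_1 poly"
  shows "map_poly (\<lambda>x. a * x) (p + q) = map_poly (\<lambda>x. a * x) p + map_poly (\<lambda>x. a * x) q"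
  by (intro poly_eqI) (simp add: coeff_map_poly algebra_simps)

lemma map_poly_add_scale:
  fixes p :: "'a::ring_1 poly"
  shows "map_poly (\<lambda>x. (a + b) * x) p = map_poly (\<lambda>x. a * x) p + map_poly (\<lambda>x. b * x) p"
  by (intro poly_eqI) (simp add: coeff_map_poly algebra_simps)

lemma map_poly_scale_scale:
  fixes p :: "'a::ring_1 poly"
  shows "map_poly (\<lambda>x. a * x) (map_poly (\<lambda>x. b * x) p) = map_poly (\<lambda>x. (a * b) * x) p"
  by (intro poly_eqI) (simp add: coeff_map_poly algebra_simps)

lemma map_poly_scale_sum:
  fixes f :: "'b \<Rightarrow> 'a::ring_1 poly"
  shows "map_poly (\<lambda>x. a * x) (\<Sum>i\<in>A. f i) = (\<Sum>i\<in>A. map_poly (\<lambda>x. a * x) (f i))"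
  by (induction A rule: infinite_finite_induct) (simp_all add: map_poly_scale_add)

lemma map_poly_scale_0:
  fixes p :: "'a::ring_1 poly"
  shows "map_poly (\<lambda>x. 0 * x) p = 0"
  by (intro poly_eqI) (simp add: coeff_map_poly)

lemma ore_mult_upto:
  assumes "degree p \<le> n"
  shows "ore_mult \<sigma> \<delta> p q =
           (\<Sum>i\<le>n. map_poly (\<lambda>x. coeff p i * x) ((ore_shift \<sigma> \<delta> ^^ i) q))"
  unfolding ore_mult_def
proof (rule sum.mono_neutral_left)
  show "\<forall>i\<in>{..n} - {..degree p}.
          map_poly (\<lambda>x. coeff p i * x) ((ore_shift \<sigma> \<delta> ^^ i) q) = 0"
  proof
    fix i assume "i \<in> {..n} - {..degree p}"
    then have "coeff p i = 0" by (simp add: coeff_eq_0)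
    then show "map_poly (\<lambda>x. coeff p i * x) ((ore_shift \<sigma> \<delta> ^^ i) q) = 0"
      by (simp only: map_poly_scale_0)
  qed
qed (use assms in auto)

lemma ore_mult_0_left: "ore_mult \<sigma> \<delta> 0 q = 0"
  unfolding ore_mult_def coeff_0 map_poly_scale_0 by simp

lemma ore_mult_add_left:
  "ore_mult \<sigma> \<delta> (p + p') q = ore_mult \<sigma> \<delta> p q + ore_mult \<sigma> \<delta> p' q"
proof -
  let ?n = "max (degree p) (degree p')"
  have "degree (p + p') \<le> ?n" by (rule degree_add_le_max)
  then show ?thesis
    by (simp add: ore_mult_upto[of _ ?n] map_poly_add_scale sum.distrib)
qed

lemma ore_mult_add_right:
  assumes "automorphism \<sigma>" "skew_derivation \<sigma> \<delta>"
  shows "ore_mult \<sigma> \<delta> p (q + q') = ore_mult \<sigma> \<delta> p q + ore_mult \<sigma> \<delta> p q'"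
  by (simp add: ore_mult_def ore_shift_funpow_add[OF assms] map_poly_scale_add sum.distrib)

lemma ore_mult_sum_left:
  "ore_mult \<sigma> \<delta> (\<Sum>i\<in>A. f i) q = (\<Sum>i\<in>A. ore_mult \<sigma> \<delta> (f i) q)"
  by (induction A rule: infinite_finite_induct)
     (simp_all add: ore_mult_add_left ore_mult_0_left)

lemma ore_mult_scale_left:
  "ore_mult \<sigma> \<delta> (map_poly (\<lambda>x. a * x) p) q = map_poly (\<lambda>x. a * x) (ore_mult \<sigma> \<delta> p q)"
proof -
  have "degree (map_poly (\<lambda>x. a * x) p) \<le> degree p"
    by (rule degree_le) (simp add: coeff_map_poly coeff_eq_0)
  then have "ore_mult \<sigma> \<delta> (map_poly (\<lambda>x. a * x) p) q =
      (\<Sum>i\<le>degree p. map_poly (\<lambda>x. (a * coeff p i) * x) ((ore_shift \<sigma> \<delta> ^^ i) q))"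
    by (simp add: ore_mult_upto[of _ "degree p"] coeff_map_poly)
  then show ?thesis
    by (simp add: ore_mult_def map_poly_scale_sum map_poly_scale_scale)
qed

lemma ore_mult_shift_left:
  assumes "automorphism \<sigma>" "skew_derivation \<sigma> \<delta>"
  shows "ore_mult \<sigma> \<delta> (ore_shift \<sigma> \<delta> p) q = ore_shift \<sigma> \<delta> (ore_mult \<sigma> \<delta> p q)"
proof -
  let ?T = "ore_shift \<sigma> \<delta>" and ?n = "degree p"
  let ?s = "\<lambda>a q. map_poly (\<lambda>x. a * x) q"
  note \<delta>0 = skew_derivation_0[OF assms(2)]
  have deg: "degree (?T p) \<le> Suc ?n"
    by (rule degree_le)
       (auto simp: coeff_ore_shift[OF assms] coeff_eq_0 automorphism_0[OF assms(1)] \<delta>0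
          split: nat.split)
  have "ore_mult \<sigma> \<delta> (?T p) q = (\<Sum>i\<le>Suc ?n. ?s (coeff (?T p) i) ((?T ^^ i) q))"
    by (rule ore_mult_upto[OF deg])
  also have "\<dots> = (\<Sum>i\<le>Suc ?n. ?s (case i of 0 \<Rightarrow> 0 | Suc m \<Rightarrow> \<sigma> (coeff p m)) ((?T ^^ i) q))
      + (\<Sum>i\<le>Suc ?n. ?s (\<delta> (coeff p i)) ((?T ^^ i) q))"
    by (simp only: coeff_ore_shift[OF assms] map_poly_add_scale sum.distrib)
  also have "(\<Sum>i\<le>Suc ?n. ?s (case i of 0 \<Rightarrow> 0 | Suc m \<Rightarrow> \<sigma> (coeff p m)) ((?T ^^ i) q))
      = (\<Sum>i\<le>?n. ?s (\<sigma> (coeff p i)) (?T ((?T ^^ i) q)))"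
    by (simp only: sum.atMost_Suc_shift nat.case map_poly_scale_0 add_0 funpow.simps o_apply)
  also have "(\<Sum>i\<le>Suc ?n. ?s (\<delta> (coeff p i)) ((?T ^^ i) q))
      = (\<Sum>i\<le>?n. ?s (\<delta> (coeff p i)) ((?T ^^ i) q))"
    by (simp only: sum.atMost_Suc coeff_eq_0[OF lessI] \<delta>0 map_poly_scale_0 add_0_right)
  also have "(\<Sum>i\<le>?n. ?s (\<sigma> (coeff p i)) (?T ((?T ^^ i) q)))
      + (\<Sum>i\<le>?n. ?s (\<delta> (coeff p i)) ((?T ^^ i) q)) = ?T (ore_mult \<sigma> \<delta> p q)"
    by (simp add: ore_mult_def ore_shift_sum[OF assms] ore_shift_scale[OF assms] sum.distrib)
  finally show ?thesis .
qed

lemma ore_mult_shift_funpow_left: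
  assumes "automorphism \<sigma>" "skew_derivation \<sigma> \<delta>"
  shows "ore_mult \<sigma> \<delta> ((ore_shift \<sigma> \<delta> ^^ i) p) q = (ore_shift \<sigma> \<delta> ^^ i) (ore_mult \<sigma> \<delta> p q)"
  by (induction i) (simp_all add: ore_mult_shift_left[OF assms])

lemma ore_mult_assoc:
  assumes "automorphism \<sigma>" "skew_derivation \<sigma> \<delta>"
  shows "ore_mult \<sigma> \<delta> (ore_mult \<sigma> \<delta> p q) r = ore_mult \<sigma> \<delta> p (ore_mult \<sigma> \<delta> q r)"
  unfolding ore_mult_def[of _ _ p]
  by (simp add: ore_mult_sum_left ore_mult_scale_left ore_mult_shift_funpow_left[OF assms])

lemma ore_mult_const_left: "ore_mult \<sigma> \<delta> [:a:] q = map_poly (\<lambda>x. a * x) q"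
  by (simp add: ore_mult_def)

lemma ore_mult_one_left: "ore_mult \<sigma> \<delta> [:1:] q = q"
  by (intro poly_eqI) (simp add: ore_mult_const_left coeff_map_poly)

lemma ore_shift_funpow_one:
  assumes "automorphism \<sigma>" "skew_derivation \<sigma> \<delta>"
  shows "(ore_shift \<sigma> \<delta> ^^ i) [:1:] = monom 1 i"
proof (induction i)
  case 0
  show ?case by (simp add: monom_0)
next
  case (Suc i)
  have "\<sigma> 1 = 1" using assms(1) by (simp add: automorphism_def unital_hom_def)
  moreover have "\<delta> (1 * 1) = \<delta> 1 * 1 + \<sigma> 1 * \<delta> 1"
    using assms(2) unfolding skew_derivation_def by blast
  ultimately show ?case
    by (intro poly_eqI) (simp add: Suc coeff_ore_shift[OF assms] automorphism_0[OF assms(1)]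
         skew_derivation_0[OF assms(2)] split: nat.split)
qed

lemma ore_mult_one_right:
  assumes "automorphism \<sigma>" "skew_derivation \<sigma> \<delta>"
  shows "ore_mult \<sigma> \<delta> p [:1:] = p"
proof -
  have "ore_mult \<sigma> \<delta> p [:1:] = (\<Sum>i\<le>degree p. monom (coeff p i) i)"
    by (simp add: ore_mult_def ore_shift_funpow_one[OF assms] map_poly_monom)
  also have "\<dots> = p" by (rule poly_as_sum_of_monoms)
  finally show ?thesis .
qed

theorem ring_ore_ext:
  assumes "automorphism \<sigma>" "skew_derivation \<sigma> \<delta>"
  shows "ring (ore_ext \<sigma> \<delta>)"
proof (rule ringI)
  show "abelian_group (ore_ext \<sigma> \<delta>)"
  proof (rule abelian_groupI)
    fix p assume "p \<in> carrier (ore_ext \<sigma> \<delta>)"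
    show "\<exists>q\<in>carrier (ore_ext \<sigma> \<delta>). q \<oplus>\<^bsub>ore_ext \<sigma> \<delta>\<^esub> p = \<zero>\<^bsub>ore_ext \<sigma> \<delta>\<^esub>"
      by (rule bexI[of _ "- p"]) (simp_all add: ore_ext_def)
  qed (simp_all add: ore_ext_def add.assoc add.commute)
  show "Group.monoid (ore_ext \<sigma> \<delta>)"
    by (rule monoidI)
       (simp_all add: ore_ext_def ore_mult_assoc[OF assms] ore_mult_one_left
          ore_mult_one_right[OF assms])
qed (simp_all add: ore_ext_def ore_mult_add_left ore_mult_add_right[OF assms])

theorem ore_ext_commute:
  assumes "automorphism \<sigma>" "skew_derivation \<sigma> \<delta>"
  shows "monom 1 1 \<otimes>\<^bsub>ore_ext \<sigma> \<delta>\<^esub> [:r:] =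
           ([:\<sigma> r:] \<otimes>\<^bsub>ore_ext \<sigma> \<delta>\<^esub> monom 1 1) \<oplus>\<^bsub>ore_ext \<sigma> \<delta>\<^esub> [:\<delta> r:]"
proof -
  have "ore_mult \<sigma> \<delta> (ore_shift \<sigma> \<delta> [:1:]) [:r:] = ore_shift \<sigma> \<delta> [:r:]"
    by (simp add: ore_mult_shift_left[OF assms] ore_mult_one_left)
  then have "ore_mult \<sigma> \<delta> (monom 1 1) [:r:] = ore_shift \<sigma> \<delta> [:r:]"
    using ore_shift_funpow_one[OF assms, of 1] by simp
  also have "\<dots> = monom (\<sigma> r) 1 + [:\<delta> r:]"
    by (intro poly_eqI)
       (auto simp: coeff_ore_shift[OF assms] coeff_pCons automorphism_0[OF assms(1)]
         skew_derivation_0[OF assms(2)] split: nat.split)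
  finally show ?thesis
    by (simp add: ore_ext_def ore_mult_const_left map_poly_monom)
qed

theorem ore_ext_monom:
  assumes "automorphism \<sigma>" "skew_derivation \<sigma> \<delta>"
  shows "monom r i = [:r:] \<otimes>\<^bsub>ore_ext \<sigma> \<delta>\<^esub> (monom 1 1 [^]\<^bsub>ore_ext \<sigma> \<delta>\<^esub> i)"
proof -
  interpret S: ring "ore_ext \<sigma> \<delta>" by (rule ring_ore_ext[OF assms])
  have "monom 1 1 [^]\<^bsub>ore_ext \<sigma> \<delta>\<^esub> i = monom 1 i"
  proof (induction i)
    case 0
    show ?case by (simp add: ore_ext_def monom_0)
  next
    case (Suc i)
    have "ore_mult \<sigma> \<delta> (monom 1 i) (monom 1 1)
        = (ore_shift \<sigma> \<delta> ^^ i) ((ore_shift \<sigma> \<delta> ^^ 1) [:1:])"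
      using ore_mult_shift_funpow_left[OF assms, of i "[:1:]"]
      by (simp only: ore_shift_funpow_one[OF assms] ore_mult_one_left)
    also have "\<dots> = (ore_shift \<sigma> \<delta> ^^ (i + 1)) [:1:]" by (simp only: funpow_add o_apply)
    also have "\<dots> = monom 1 (Suc i)" using ore_shift_funpow_one[OF assms, of "i + 1"] by simp
    finally show ?case using Suc by (simp add: ore_ext_def)
  qed
  then show ?thesis by (simp add: ore_ext_def ore_mult_const_left map_poly_monom)
qed

end

theory Submission
  imports Defs
begin

text \<open>
  Degrees are additive in an Ore extension of a domain, so over the division ring \<open>Q\<close> a proper
  factorisation of \<open>F\<close> has two linear factors; moving the leading coefficient of the right factor
  to the left one makes both monic, and comparing coefficients gives part 1.
  For part 2, clearing denominators in \<open>F = (t - \<sigma>(w))(t + w)\<close> produces \<open>uF = bc\<close> in \<open>S\<close> with \<open>b\<close>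
  and \<open>c\<close> linear, and \<open>F\<close> cannot divide a linear polynomial. Conversely, if \<open>F\<close> is normal and
  divides \<open>bc\<close>, then it divides the product of the remainders of \<open>b\<close> and \<open>c\<close> modulo \<open>F\<close>; if both
  are nonzero, then degrees force this product to be \<open>rF\<close> with \<open>r\<close> a constant, which factors \<open>F\<close>
  over \<open>Q\<close>.
\<close>

section \<open>Degrees, zero divisors and division with remainder in an Ore extension of a
  domain\<close>

locale ore_domain =
  fixes \<sigma> \<delta> :: "'a::ring_1_no_zero_divisors \<Rightarrow> 'a"
  assumes automorphism: "automorphism \<sigma>" and skew_derivation: "skew_derivation \<sigma> \<delta>"
begin

abbreviation times :: "'a poly \<Rightarrow> 'a poly \<Rightarrow> 'a poly" (infixl "\<star>" 70) where
  "p \<star> q \<equiv> ore_mult \<sigma> \<delta> p q"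

lemmas times_assoc = ore_mult_assoc[OF automorphism skew_derivation]
  and times_add_right = ore_mult_add_right[OF automorphism skew_derivation]
  and coeff_shift = coeff_ore_shift[OF automorphism skew_derivation]

lemma sigma_0 [simp]: "\<sigma> 0 = 0"
  by (rule automorphism_0[OF automorphism])

lemma sigma_1 [simp]: "\<sigma> 1 = 1"
  using automorphism by (simp add: automorphism_def unital_hom_def)

lemma delta_0 [simp]: "\<delta> 0 = 0"
  by (rule skew_derivation_0[OF skew_derivation])

lemma delta_1 [simp]: "\<delta> 1 = 0"
proof -
  have "\<delta> (1 * 1) = \<delta> 1 * 1 + \<sigma> 1 * \<delta> 1"
    using skew_derivation unfolding skew_derivation_def by blast
  then show ?thesis by simp
qed

lemma sigma_eq_0_iff [simp]: "\<sigma> x = 0 \<longleftrightarrow> x = 0"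
  using automorphism sigma_0 unfolding automorphism_def by (metis bij_is_inj injD)

lemma sigma_funpow_eq_0_iff [simp]: "(\<sigma> ^^ i) x = 0 \<longleftrightarrow> x = 0"
  by (induction i) simp_all

lemma sigma_funpow_1 [simp]: "(\<sigma> ^^ i) 1 = 1"
  by (induction i) simp_all

lemma coeff_shift_funpow_eq_0: "degree q + i < n \<Longrightarrow> coeff ((ore_shift \<sigma> \<delta> ^^ i) q) n = 0"
  by (induction i arbitrary: n) (auto simp: coeff_shift coeff_eq_0 split: nat.split)

text \<open>Each multiplication by \<open>t\<close> applies \<open>\<sigma>\<close> to the leading
  coefficient and raises its index by one; the \<open>\<delta>\<close> part contributes only to
  lower indices.\<close>

lemma coeff_shift_funpow_top:
  "coeff ((ore_shift \<sigma> \<delta> ^^ i) q) (degree q + i) = (\<sigma> ^^ i) (lead_coeff q)"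
  by (induction i) (simp_all add: coeff_shift coeff_shift_funpow_eq_0)

lemma degree_times_le: "degree (p \<star> q) \<le> degree p + degree q"
  by (rule degree_le)
     (auto simp: ore_mult_def coeff_sum coeff_map_poly coeff_shift_funpow_eq_0 intro!: sum.neutral)

text \<open>Only the summand with \<open>i = degree p\<close> reaches this index. As
  \<open>\<sigma>\<close> is injective and there are no zero divisors, the value is nonzero for
  nonzero \<open>p\<close> and \<open>q\<close>, which yields both additivity of degrees and the
  absence of zero divisors.\<close>

lemma coeff_times_top:
  "coeff (p \<star> q) (degree p + degree q) = lead_coeff p * (\<sigma> ^^ degree p) (lead_coeff q)"
proof -
  have "coeff (p \<star> q) (degree p + degree q) =
      (\<Sum>i\<le>degree p. coeff p i * coeff ((ore_shift \<sigma> \<delta> ^^ i) q) (degree p + degree q))"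
    by (simp add: ore_mult_def coeff_sum coeff_map_poly)
  also have "\<dots> = (\<Sum>i\<in>{degree p}.
      coeff p i * coeff ((ore_shift \<sigma> \<delta> ^^ i) q) (degree p + degree q))"
    by (rule sum.mono_neutral_right) (auto simp: coeff_shift_funpow_eq_0)
  finally show ?thesis
    using coeff_shift_funpow_top[of "degree p" q] by (simp add: add.commute)
qed

lemma degree_times:
  assumes "p \<noteq> 0" "q \<noteq> 0"
  shows "degree (p \<star> q) = degree p + degree q"
proof (rule antisym[OF degree_times_le le_degree])
  show "coeff (p \<star> q) (degree p + degree q) \<noteq> 0"
    using assms by (simp add: coeff_times_top)
qed

lemma times_0_left [simp]: "0 \<star> q = 0"
  by (rule ore_mult_0_left)

lemma times_0_right [simp]: "p \<star> 0 = 0"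
  using times_add_right[of p 0 0] by simp

lemma times_eq_0_iff [simp]: "p \<star> q = 0 \<longleftrightarrow> p = 0 \<or> q = 0"
proof (cases "p = 0 \<or> q = 0")
  case False
  then have "coeff (p \<star> q) (degree p + degree q) \<noteq> 0"
    by (simp add: coeff_times_top)
  then show ?thesis using False by auto
qed auto

lemma times_linear:
  "[:b0, b1:] \<star> [:c0, c1:] =
     [:b0 * c0 + b1 * \<delta> c0, b0 * c1 + b1 * \<sigma> c0 + b1 * \<delta> c1, b1 * \<sigma> c1:]"
  by (intro poly_eqI)
     \<comment> \<open>Summing up to index 1 instead of up to the degree also covers
       \<open>b1 = 0\<close>, so that constants can be handled as linear polynomials.\<close>
     (auto simp: ore_mult_upto[of _ 1] coeff_map_poly coeff_shift coeff_pCons algebra_simps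
       split: nat.split)

text \<open>The constant term \<open>- \<sigma> w\<close> on the left is what cancels the
  contribution \<open>\<sigma> w\<close> of \<open>t w\<close> to the coefficient of
  \<open>t\<close>.\<close>

lemma monic_factorisation_eq:
  "[:- \<sigma> w, 1:] \<star> [:w, 1:] = [:\<delta> w - \<sigma> w * w, 0, 1:]"
  by (simp add: times_linear)

lemma right_division_by_monic:
  assumes "lead_coeff f = 1"
  shows "\<exists>q r. p = q \<star> f + r \<and> (r = 0 \<or> degree r < degree f)"
proof (induction "degree p" arbitrary: p rule: less_induct)
  case less
  show ?case
  proof (cases "p = 0 \<or> degree p < degree f")
    case True
    then have "p = 0 \<star> f + p \<and> (p = 0 \<or> degree p < degree f)" by simp
    then show ?thesis by blast
  next
    case False
    \<comment> \<open>Powers of \<open>\<sigma>\<close> fix the leading coefficient 1 of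
      \<open>f\<close>, so \<open>?m \<star> f\<close> has the same leading term as
      \<open>p\<close>, and the difference is zero or of smaller degree.\<close>
    let ?m = "monom (lead_coeff p) (degree p - degree f)"
    let ?p = "p - ?m \<star> f"
    have "?m \<noteq> 0" "f \<noteq> 0" using False assms by auto
    then have deg: "degree (?m \<star> f) = degree p"
      using False by (simp add: degree_times degree_monom_eq)
    have "coeff (?m \<star> f) (degree ?m + degree f) = lead_coeff p"
      using False assms by (simp only: coeff_times_top) (simp add: degree_monom_eq)
    then have top: "coeff ?p (degree p) = 0"
      using False by (simp add: degree_monom_eq)
    have "\<exists>q r. ?p = q \<star> f + r \<and> (r = 0 \<or> degree r < degree f)"
    proof (cases "?p = 0")
      case True
      then have "?p = 0 \<star> f + 0" by simp
      then show ?thesis by blast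
    next
      case False
      have "degree ?p \<le> degree p" using deg by (simp add: degree_diff_le)
      moreover have "degree ?p \<noteq> degree p" using top False by (metis leading_coeff_0_iff)
      ultimately show ?thesis using less by simp
    qed
    then obtain q r where "?p = q \<star> f + r" and r: "r = 0 \<or> degree r < degree f" by blast
    then have "p = (q + ?m) \<star> f + r" by (simp add: ore_mult_add_left algebra_simps)
    then show ?thesis using r by blast
  qed
qed

lemma prime_elem_ore_ext_iff:
  "prime_elem_nc (ore_ext \<sigma> \<delta>) f \<longleftrightarrow>
     (\<forall>b c. (\<exists>x. b \<star> c = f \<star> x \<or> b \<star> c = x \<star> f) \<longrightarrow>
        (\<exists>x. b = f \<star> x \<or> b = x \<star> f) \<or> (\<exists>x. c = f \<star> x \<or> c = x \<star> f))"
  by (simp add: prime_elem_nc_def divides_elem_def ore_ext_def)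

text \<open>This turns left multiples of \<open>f\<close> into right multiples, the kind that
  division with remainder produces.\<close>

lemma normal_elem_ore_extD:
  assumes "normal_elem (ore_ext \<sigma> \<delta>) f"
  shows "\<exists>y. f \<star> x = y \<star> f"
  using assms unfolding normal_elem_def ore_ext_def by auto

end

section \<open>Units, irreducibility and linear factors over a division ring\<close>

lemma Units_ore_ext:
  fixes \<sigma> \<delta> :: "'q::division_ring \<Rightarrow> 'q"
  assumes "ore_domain \<sigma> \<delta>"
  shows "p \<in> Units (ore_ext \<sigma> \<delta>) \<longleftrightarrow> p \<noteq> 0 \<and> degree p = 0"
proof -
  interpret ore_domain \<sigma> \<delta> by (rule assms)
  show ?thesis
  proof
    assume "p \<in> Units (ore_ext \<sigma> \<delta>)"
    then obtain q where q: "p \<star> q = [:1:]"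
      by (auto simp: Units_def ore_ext_def)
    then have "p \<star> q \<noteq> 0" by simp
    then have "p \<noteq> 0" "q \<noteq> 0" by auto
    then show "p \<noteq> 0 \<and> degree p = 0" using q degree_times[of p q] by simp
  next
    assume "p \<noteq> 0 \<and> degree p = 0"
    then obtain c where c: "p = [:c:]" "c \<noteq> 0" by (metis degree_eq_zeroE pCons_0_0)
    have "[:c:] \<star> [:inverse c:] = [:1:]" "[:inverse c:] \<star> [:c:] = [:1:]"
      using c by (simp_all add: ore_mult_const_left map_poly_pCons)
    then show "p \<in> Units (ore_ext \<sigma> \<delta>)"
      using c by (auto simp: Units_def ore_ext_def)
  qed
qed

text \<open>Units are the nonzero constants and degrees add up to 2, so 1 + 1 is the only split
  without a unit.\<close>

lemma irreducible_elem_degree_2_iff: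
  fixes \<sigma> \<delta> :: "'q::division_ring \<Rightarrow> 'q"
  assumes "ore_domain \<sigma> \<delta>" and "degree f = 2"
  shows "irreducible_elem (ore_ext \<sigma> \<delta>) f \<longleftrightarrow>
           (\<forall>b c. f = ore_mult \<sigma> \<delta> b c \<longrightarrow> \<not> (degree b = 1 \<and> degree c = 1))"
proof -
  interpret ore_domain \<sigma> \<delta> by (rule assms)
  have "(b \<noteq> 0 \<and> degree b = 0 \<or> c \<noteq> 0 \<and> degree c = 0) \<longleftrightarrow> \<not> (degree b = 1 \<and> degree c = 1)"
    if "f = b \<star> c" for b c
  proof -
    have "f \<noteq> 0" using assms(2) by auto
    then have "b \<noteq> 0" "c \<noteq> 0" using that by auto
    then show ?thesis using degree_times[of b c] that assms(2) by auto
  qed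
  moreover have "irreducible_elem (ore_ext \<sigma> \<delta>) f \<longleftrightarrow>
      (\<forall>b c. f = b \<star> c \<longrightarrow> b \<noteq> 0 \<and> degree b = 0 \<or> c \<noteq> 0 \<and> degree c = 0)"
    using assms(2)
    by (simp add: irreducible_elem_def Units_ore_ext[OF assms(1)]) (simp add: ore_ext_def)
  ultimately show ?thesis by blast
qed

lemma monic_linear_factors:
  fixes \<sigma> \<delta> :: "'q::division_ring \<Rightarrow> 'q"
  assumes "ore_domain \<sigma> \<delta>"
    and f: "[:- v, 0, 1:] = ore_mult \<sigma> \<delta> b c" and deg: "degree b = 1" "degree c = 1"
  shows "\<exists>w. [:- v, 0, 1:] = ore_mult \<sigma> \<delta> [:- \<sigma> w, 1:] [:w, 1:]"
proof -
  interpret ore_domain \<sigma> \<delta> by (rule assms)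
  obtain b0 b1 where b: "b = [:b0, b1:]" using deg(1) by (metis degree1_coeffs One_nat_def)
  obtain c0 c1 where c: "c = [:c0, c1:]" "c1 \<noteq> 0" using deg(2) by (metis degree1_coeffs One_nat_def)
  \<comment> \<open>Chosen so that \<open>c\<close> becomes \<open>c1 (t + w)\<close>.\<close>
  define w where "w = inverse c1 * c0"
  have "c = [:c1:] \<star> [:w, 1:]"
    using c by (simp add: ore_mult_const_left map_poly_pCons w_def mult.assoc[symmetric])
  \<comment> \<open>The constant \<open>c1\<close> is read as a linear polynomial with zero
    coefficient of \<open>t\<close>. The values of \<open>x\<close> and \<open>y\<close> are left
    open here; comparison with \<open>t^2 - v\<close> fixes them below.\<close>
  moreover obtain x y where "b \<star> [:c1:] = [:x, y:]"
    using times_linear[of b0 b1 c1 0] b by simp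
  ultimately have eq: "[:- v, 0, 1:] = [:x, y:] \<star> [:w, 1:]"
    using f by (simp add: times_assoc[symmetric])
  then have "y = 1" and "x + y * \<sigma> w = 0" by (auto simp: times_linear)
  then have "y = 1" "x = - \<sigma> w" by (simp_all add: eq_neg_iff_add_eq_0)
  then show ?thesis using eq by auto
qed

section \<open>Passage between the domain and its quotient ring: the embedding of Ore extensions and
  common denominators\<close>

lemma unital_hom_0: "unital_hom f \<Longrightarrow> f 0 = 0"
  unfolding unital_hom_def by (metis add_cancel_right_left)

lemma map_poly_unital_hom_add:
  "unital_hom f \<Longrightarrow> map_poly f (p + q) = map_poly f p + map_poly f q"
  by (intro poly_eqI) (simp add: coeff_map_poly unital_hom_0, simp add: unital_hom_def)

lemma map_poly_unital_hom_sum: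
  "unital_hom f \<Longrightarrow> map_poly f (\<Sum>i\<in>A. p i) = (\<Sum>i\<in>A. map_poly f (p i))"
  by (induction A rule: infinite_finite_induct) (simp_all add: map_poly_unital_hom_add)

text \<open>For the quotient embedding this is the inclusion of S in Q[t]. It holds because
  \<open>f\<close> intertwines the two shifts, hence also their powers.\<close>

lemma map_poly_ore_mult:
  assumes hom: "unital_hom f"
    and "automorphism \<sigma>" "skew_derivation \<sigma> \<delta>" "automorphism \<sigma>'" "skew_derivation \<sigma>' \<delta>'"
    and "\<And>r. \<sigma>' (f r) = f (\<sigma> r)" "\<And>r. \<delta>' (f r) = f (\<delta> r)"
  shows "map_poly f (ore_mult \<sigma> \<delta> p q) = ore_mult \<sigma>' \<delta>' (map_poly f p) (map_poly f q)"
proof -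
  note [simp] = unital_hom_0[OF hom]
  have shift: "map_poly f (ore_shift \<sigma> \<delta> p) = ore_shift \<sigma>' \<delta>' (map_poly f p)" for p
    using hom assms
    by (intro poly_eqI) (auto simp: coeff_map_poly coeff_ore_shift unital_hom_def split: nat.split)
  have funpow: "map_poly f ((ore_shift \<sigma> \<delta> ^^ i) q) = (ore_shift \<sigma>' \<delta>' ^^ i) (map_poly f q)" for i
    by (induction i) (simp_all add: shift)
  have scale: "map_poly f (map_poly (\<lambda>x. a * x) p) = map_poly (\<lambda>x. f a * x) (map_poly f p)" for a p
    using hom by (intro poly_eqI) (simp add: coeff_map_poly unital_hom_def)
  \<comment> \<open>The map \<open>f\<close> may kill leading coefficients, so both products are
    expanded up to the common bound \<open>degree p\<close>.\<close>
  have "degree (map_poly f p) \<le> degree p" by (rule degree_le) (simp add: coeff_map_poly coeff_eq_0 hom)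
  then show ?thesis
    by (simp add: ore_mult_upto[of _ "degree p"] map_poly_unital_hom_sum[OF hom] scale funpow
        coeff_map_poly)
qed

lemma map_poly_inj:
  assumes "inj f" "f 0 = 0" and "map_poly f p = map_poly f q"
  shows "p = q"
  using assms by (metis coeff_map_poly injD poly_eqI)

text \<open>The left Ore condition comes from rewriting the right fraction \<open>s1 s2\<inverse>\<close> as a left fraction.\<close>

lemma common_left_denominator:
  fixes \<iota> :: "'a::ring_1_no_zero_divisors \<Rightarrow> 'b::division_ring"
  assumes "classical_quotient_ring \<iota>"
  shows "\<exists>u x y. u \<noteq> 0 \<and> \<iota> u * p = \<iota> x \<and> \<iota> u * q = \<iota> y"
proof -
  have uh: "unital_hom \<iota>" and inj: "inj \<iota>"
    using assms by (simp_all add: classical_quotient_ring_def)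
  have hom: "\<iota> (x * y) = \<iota> x * \<iota> y" for x y using uh by (simp add: unital_hom_def)
  have nz: "\<iota> x \<noteq> 0" if "x \<noteq> 0" for x
    using inj unital_hom_0[OF uh] that by (metis injD)
  have frac: "\<exists>a s. s \<noteq> 0 \<and> z = inverse (\<iota> s) * \<iota> a" for z
    using assms unfolding classical_quotient_ring_def by blast
  obtain a1 s1 where 1: "s1 \<noteq> 0" "p = inverse (\<iota> s1) * \<iota> a1" using frac by blast
  obtain a2 s2 where 2: "s2 \<noteq> 0" "q = inverse (\<iota> s2) * \<iota> a2" using frac by blast
  obtain b c where 3: "c \<noteq> 0" "\<iota> s1 * inverse (\<iota> s2) = inverse (\<iota> c) * \<iota> b" using frac by blast
  have cancel: "y * inverse x * x = y" "x * (inverse x * y) = y" if "x \<noteq> 0" for x y :: 'b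
    using that by (simp_all add: mult.assoc) (simp flip: mult.assoc)
  have "\<iota> c * \<iota> s1 = \<iota> c * (\<iota> s1 * inverse (\<iota> s2)) * \<iota> s2"
    using cancel(1)[OF nz[OF 2(1)]] by (metis mult.assoc)
  also have "\<dots> = \<iota> b * \<iota> s2"
    by (simp only: 3(2) cancel(2)[OF nz[OF 3(1)]])
  finally have u: "\<iota> (c * s1) = \<iota> b * \<iota> s2" by (simp only: hom)
  have "\<iota> (c * s1) * p = \<iota> (c * a1)"
    by (simp only: hom 1(2) mult.assoc cancel(2)[OF nz[OF 1(1)]])
  moreover have "\<iota> (c * s1) * q = \<iota> (b * a2)"
    by (simp only: u 2(2) mult.assoc cancel(2)[OF nz[OF 2(1)]]) (simp only: hom)
  moreover have "c * s1 \<noteq> 0" using 1 3 by simp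
  ultimately show ?thesis by blast
qed

section \<open>Factorisation and primality of \<open>t^2 - v\<close>\<close>

theorem theorem3:
  fixes \<sigma> \<delta> :: "'r::ring_1_no_zero_divisors \<Rightarrow> 'r"
    and \<iota> :: "'r \<Rightarrow> 'q::division_ring"
    and \<sigma>Q \<delta>Q :: "'q \<Rightarrow> 'q"
    and v :: 'r
    and S :: "'r poly ring" and SQ :: "'q poly ring"
    and F :: "'r poly" and FQ :: "'q poly"
  assumes "noetherian TYPE('r)"
    and "automorphism \<sigma>" and "skew_derivation \<sigma> \<delta>"
    and "classical_quotient_ring \<iota>"
    and "automorphism \<sigma>Q" and "\<And>r. \<sigma>Q (\<iota> r) = \<iota> (\<sigma> r)"
    and "skew_derivation \<sigma>Q \<delta>Q" and "\<And>r. \<delta>Q (\<iota> r) = \<iota> (\<delta> r)"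
    and "S = ore_ext \<sigma> \<delta>" and "SQ = ore_ext \<sigma>Q \<delta>Q"
    and "F = monom 1 2 - [:v:]" and "FQ = map_poly \<iota> F"
  shows "(reducible_elem SQ FQ \<longrightarrow>
            (\<exists>w. FQ = (monom 1 1 - [:\<sigma>Q w:]) \<otimes>\<^bsub>SQ\<^esub> (monom 1 1 + [:w:])) \<and>
            (\<forall>w. FQ = (monom 1 1 - [:\<sigma>Q w:]) \<otimes>\<^bsub>SQ\<^esub> (monom 1 1 + [:w:]) \<longrightarrow>
                 \<iota> v = \<sigma>Q w * w - \<delta>Q w)) \<and>
         (normal_elem S F \<longrightarrow> (prime_elem_nc S F \<longleftrightarrow> irreducible_elem SQ FQ))"
proof -
  note [simp] = assms(9,10)
  interpret S: ore_domain \<sigma> \<delta> using assms(2,3) by unfold_locales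
  interpret SQ: ore_domain \<sigma>Q \<delta>Q using assms(5,7) by unfold_locales
  have hom: "unital_hom \<iota>" and inj: "inj \<iota>"
    using assms(4) by (simp_all add: classical_quotient_ring_def)
  have \<iota>0 [simp]: "\<iota> 0 = 0" by (rule unital_hom_0[OF hom])
  have \<iota>_eq_0 [simp]: "\<iota> x = 0 \<longleftrightarrow> x = 0" for x using inj \<iota>0 by (metis injD)
  have \<iota>1: "\<iota> 1 = 1" and \<iota>_minus: "\<iota> (- v) = - \<iota> v"
    using hom \<iota>0 unfolding unital_hom_def by (simp, metis eq_neg_iff_add_eq_0)
  note map_mult = map_poly_ore_mult[OF hom assms(2,3,5,7,6,8)]
  have F: "F = [:- v, 0, 1:]" by (simp add: assms(11) numeral_2_eq_2 monom_Suc monom_0)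
  have F_nz: "F \<noteq> 0" and deg_F: "degree F = 2" and monic: "lead_coeff F = 1" by (simp_all add: F)
  have FQ: "FQ = [:- \<iota> v, 0, 1:]"
    by (simp only: assms(12) F) (simp add: map_poly_pCons \<iota>1 \<iota>_minus)
  have lin: "monom 1 1 - [:\<sigma>Q w:] = [:- \<sigma>Q w, 1:]" "monom 1 1 + [:w:] = [:w, 1:]" for w
    by (simp_all add: monom_Suc monom_0)
  have irr: "irreducible_elem SQ FQ \<longleftrightarrow>
      (\<forall>b c. FQ = SQ.times b c \<longrightarrow> \<not> (degree b = 1 \<and> degree c = 1))"
    using irreducible_elem_degree_2_iff[OF SQ.ore_domain_axioms, of FQ] by (simp add: FQ)
  have factors: "\<exists>w. FQ = SQ.times [:- \<sigma>Q w, 1:] [:w, 1:]" if "\<not> irreducible_elem SQ FQ"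
    using that[unfolded irr] monic_linear_factors[OF SQ.ore_domain_axioms, of "\<iota> v"]
    unfolding FQ by blast

  have part1: "(\<exists>w. FQ = (monom 1 1 - [:\<sigma>Q w:]) \<otimes>\<^bsub>SQ\<^esub> (monom 1 1 + [:w:])) \<and>
      (\<forall>w. FQ = (monom 1 1 - [:\<sigma>Q w:]) \<otimes>\<^bsub>SQ\<^esub> (monom 1 1 + [:w:]) \<longrightarrow> \<iota> v = \<sigma>Q w * w - \<delta>Q w)"
    if "reducible_elem SQ FQ"
  proof -
    have mult: "p \<otimes>\<^bsub>SQ\<^esub> q = SQ.times p q" for p q by (simp add: ore_ext_def)
    have "\<iota> v = \<sigma>Q w * w - \<delta>Q w" if "FQ = SQ.times [:- \<sigma>Q w, 1:] [:w, 1:]" for w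
    proof -
      have "- \<iota> v = \<delta>Q w - \<sigma>Q w * w" using that by (simp add: FQ SQ.monic_factorisation_eq)
      then show ?thesis by (metis minus_diff_eq minus_minus)
    qed
    then show ?thesis
      using factors that unfolding mult lin reducible_elem_def by blast
  qed

  have prime_imp_irr: "irreducible_elem SQ FQ" if prime: "prime_elem_nc S F"
  proof (rule ccontr)
    assume "\<not> irreducible_elem SQ FQ"
    then obtain w where w: "FQ = SQ.times [:- \<sigma>Q w, 1:] [:w, 1:]" using factors by blast
    \<comment> \<open>A left fraction for \<open>w\<close> gives
      \<open>t + w = inverse s (s t + a)\<close>, whose right factor already lies in S.\<close>
    obtain a s where s: "s \<noteq> 0" "w = inverse (\<iota> s) * \<iota> a"
      using assms(4) unfolding classical_quotient_ring_def by blast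
    \<comment> \<open>These are the coefficients of \<open>(t - \<sigma>Q w) * inverse s\<close>;
      the element \<open>u\<close> below clears their denominators from the left.\<close>
    let ?q = "\<sigma>Q (inverse (\<iota> s))" and ?p = "\<delta>Q (inverse (\<iota> s)) - \<sigma>Q w * inverse (\<iota> s)"
    obtain u x y where u: "u \<noteq> 0" "\<iota> u * ?p = \<iota> y" "\<iota> u * ?q = \<iota> x"
      using common_left_denominator[OF assms(4)] by blast
    have "\<iota> x \<noteq> 0" using u(1) s(1) by (simp flip: u(3))
    then have x: "x \<noteq> 0" by simp
    have left: "SQ.times [:- \<sigma>Q w, 1:] [:inverse (\<iota> s):] = [:?p, ?q:]"
      using SQ.times_linear[of "- \<sigma>Q w" 1 "inverse (\<iota> s)" 0] by simp
    have right: "[:w, 1:] = SQ.times [:inverse (\<iota> s):] [:\<iota> a, \<iota> s:]"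
      using s by (simp add: ore_mult_const_left map_poly_pCons)
    have "FQ = SQ.times [:?p, ?q:] [:\<iota> a, \<iota> s:]"
      by (simp only: w right SQ.times_assoc[symmetric] left)
    then have "SQ.times [:\<iota> u:] FQ = SQ.times (SQ.times [:\<iota> u:] [:?p, ?q:]) [:\<iota> a, \<iota> s:]"
      by (simp only: SQ.times_assoc)
    also have "SQ.times [:\<iota> u:] [:?p, ?q:] = [:\<iota> y, \<iota> x:]"
      by (simp only: ore_mult_const_left) (simp add: map_poly_pCons u(2,3))
    finally have "map_poly \<iota> (S.times [:u:] F) = map_poly \<iota> (S.times [:y, x:] [:a, s:])"
      by (simp only: map_mult assms(12)) (simp add: map_poly_pCons)
    then have "S.times [:y, x:] [:a, s:] = S.times [:u:] F"
      using map_poly_inj[OF inj \<iota>0] by metis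
    \<comment> \<open>Primality applies because the product is the multiple \<open>u F\<close> of
      \<open>F\<close>. Both factors are linear, since \<open>x\<close> and \<open>s\<close> are
      nonzero, which is too small a degree for a nonzero multiple of \<open>F\<close>.\<close>
    then have "(\<exists>z. [:y, x:] = S.times F z \<or> [:y, x:] = S.times z F) \<or>
        (\<exists>z. [:a, s:] = S.times F z \<or> [:a, s:] = S.times z F)"
      using prime unfolding assms(9) S.prime_elem_ore_ext_iff by blast
    moreover have "degree b \<ge> 2" if "b \<noteq> 0" "b = S.times F z \<or> b = S.times z F" for b z
      using that S.degree_times[of F z] S.degree_times[of z F] F_nz deg_F by auto
    ultimately have "degree [:y, x:] \<ge> 2 \<or> degree [:a, s:] \<ge> 2" using x s(1) by (metis pCons_eq_0_iff)
    then show False using x s(1) by simp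
  qed

  have irr_imp_prime: "prime_elem_nc S F" if normal: "normal_elem S F" and "irreducible_elem SQ FQ"
    unfolding assms(9) S.prime_elem_ore_ext_iff
  proof (intro allI impI)
    note comm = S.normal_elem_ore_extD[OF normal[unfolded assms(9)]]
    fix b c assume "\<exists>x. S.times b c = S.times F x \<or> S.times b c = S.times x F"
    then obtain x where x: "S.times b c = S.times x F" using comm by metis
    obtain b' rb where b: "b = S.times b' F + rb" "rb = 0 \<or> degree rb < degree F"
      using S.right_division_by_monic[OF monic] by metis
    obtain c' rc where c: "c = S.times c' F + rc" "rc = 0 \<or> degree rc < degree F"
      using S.right_division_by_monic[OF monic] by metis
    have "rb = 0 \<or> rc = 0"
    proof (rule ccontr)
      assume nz: "\<not> (rb = 0 \<or> rc = 0)"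
      \<comment> \<open>Normality moves \<open>F\<close> past \<open>rc\<close>, so the cross term
        \<open>b' F rc\<close> is a right multiple of \<open>F\<close>. Hence \<open>rb rc\<close>
        is one too.\<close>
      obtain y where y: "S.times F rc = S.times y F" using comm by blast
      have "S.times b c = S.times (S.times b c') F + S.times (S.times b' y) F + S.times rb rc"
        by (subst c(1), simp only: S.times_add_right, subst (2) b(1))
           (simp add: ore_mult_add_left S.times_assoc y)
      then have "S.times rb rc = S.times x F - S.times (S.times b c') F - S.times (S.times b' y) F"
        by (simp add: x algebra_simps)
      also have "\<dots> = S.times (x - S.times b c' - S.times b' y) F"
        by (simp add: algebra_simps flip: ore_mult_add_left)
      finally obtain z where z: "S.times rb rc = S.times z F" by blast
      have "z \<noteq> 0" using nz z by auto
      then have "degree rb + degree rc = degree z + 2"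
        using nz z S.degree_times[of rb rc] S.degree_times[of z F] F_nz deg_F by auto
      \<comment> \<open>Both remainders have degree at most 1, while the degree of their product is
        at least 2; equality must hold throughout.\<close>
      then have deg: "degree rb = 1" "degree rc = 1" "degree z = 0" using b(2) c(2) nz deg_F by auto
      obtain r where r: "z = [:r:]" "r \<noteq> 0"
        using deg(3) \<open>z \<noteq> 0\<close> by (metis degree_eq_zeroE pCons_0_0)
      \<comment> \<open>Over Q the constant \<open>r\<close> is invertible, so absorbing its inverse
        into \<open>rb\<close> writes \<open>FQ\<close> as a product of two linear factors.\<close>
      have "SQ.times (map_poly \<iota> rb) (map_poly \<iota> rc) = SQ.times [:\<iota> r:] FQ"
        using z by (simp only: r assms(12) flip: map_mult) (simp add: map_mult map_poly_pCons)
      then have "SQ.times (SQ.times [:inverse (\<iota> r):] (map_poly \<iota> rb)) (map_poly \<iota> rc)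
          = SQ.times (SQ.times [:inverse (\<iota> r):] [:\<iota> r:]) FQ"
        by (simp only: SQ.times_assoc)
      also have "SQ.times [:inverse (\<iota> r):] [:\<iota> r:] = [:1:]"
        using r by (simp add: ore_mult_const_left map_poly_pCons)
      finally have fact: "FQ = SQ.times (SQ.times [:inverse (\<iota> r):] (map_poly \<iota> rb)) (map_poly \<iota> rc)"
        by (simp only: ore_mult_one_left)
      have dm: "degree (map_poly \<iota> p) = degree p" for p
        by (cases "p = 0") (simp_all add: degree_map_poly)
      have "map_poly \<iota> rb \<noteq> 0" using dm[of rb] deg by auto
      then have "degree (SQ.times [:inverse (\<iota> r):] (map_poly \<iota> rb)) = 1"
        using r deg by (simp add: SQ.degree_times dm)
      then show False using fact that(2) deg dm unfolding irr by metis
    qed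
    then show "(\<exists>x. b = S.times F x \<or> b = S.times x F) \<or> (\<exists>x. c = S.times F x \<or> c = S.times x F)"
      using b(1) c(1) by auto
  qed

  show ?thesis using part1 prime_imp_irr irr_imp_prime by blast
qed

end
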